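(* Let $G_2$ be a connected $k$-regular graph with $n_2$ vertices. If neither $\sqrt{(2+k)^2+16n_2}$ nor $\sqrt{(2-k)^2+16n_2}$ is an integer and $k\equiv0\pmod 4$, then $C_4\bigstar G_2$ admits pretty good state transfer.
   Context: All graphs are finite, simple and undirected; $C_4$ is the 4-cycle. For graphs $G_1$ (order $n_1$) and $G_2$, the neighborhood corona $G_1\bigstar G_2$ is obtained from one copy of $G_1$ and $n_1$ copies of $G_2$ by joining every neighbor (in $G_1$) of the $i$-th vertex of $G_1$ to every vertex of the $i$-th copy of $G_2$. A graph with adjacency matrix $A$ admits pretty good state transfer if there are distinct vertices $x,y$ such that for every $\epsilon>0$ there is a time $\tau$ with $|e_y^T\exp(-i\tau A)e_x|>1-\epsilon$. *)

theory Defs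
  imports
    "Graph_Theory.Graph_Theory"
    "Jordan_Normal_Form.Matrix"
    "HOL-Number_Theory.Cong"
begin

text \<open>
  A finite simple undirected graph is a \<^locale>\<open>pair_graph\<close>: every edge is represented by
  its two opposite arcs.
\<close>

definition regular_graph :: "'a pair_pre_digraph \<Rightarrow> nat \<Rightarrow> bool" where
  "regular_graph G k \<longleftrightarrow> (\<forall>v \<in> pverts G. out_degree (with_proj G) v = k)"

definition C4 :: "nat pair_pre_digraph" where
  "C4 = \<lparr> pverts = {0..<4},
          parcs = {(i, j). i < 4 \<and> j < 4 \<and> (j = (i + 1) mod 4 \<or> i = (j + 1) mod 4)} \<rparr>"

text \<open>
  \<^term>\<open>Inl u\<close> is the vertex \<^term>\<open>u\<close> of \<^term>\<open>G\<^sub>1\<close>, and \<^term>\<open>Inr (i, a)\<close> is the vertex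
  \<^term>\<open>a\<close> in the copy of \<^term>\<open>G\<^sub>2\<close> attached to the vertex \<^term>\<open>i\<close> of \<^term>\<open>G\<^sub>1\<close>.
\<close>

definition neighborhood_corona ::
    "'a pair_pre_digraph \<Rightarrow> 'b pair_pre_digraph \<Rightarrow> ('a + 'a \<times> 'b) pair_pre_digraph"
    (infixl \<open>\<bigstar>\<close> 70) where
  "G\<^sub>1 \<bigstar> G\<^sub>2 =
    \<lparr> pverts = pverts G\<^sub>1 <+> (pverts G\<^sub>1 \<times> pverts G\<^sub>2),
      parcs = {(Inl u, Inl v) | u v. (u, v) \<in> parcs G\<^sub>1}
        \<union> {(Inr (i, a), Inr (i, b)) | i a b. i \<in> pverts G\<^sub>1 \<and> (a, b) \<in> parcs G\<^sub>2}
        \<union> {(Inl u, Inr (i, a)) | u i a. (u, i) \<in> parcs G\<^sub>1 \<and> a \<in> pverts G\<^sub>2}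
        \<union> {(Inr (i, a), Inl u) | u i a. (u, i) \<in> parcs G\<^sub>1 \<and> a \<in> pverts G\<^sub>2} \<rparr>"

lemma pair_graph_C4: "pair_graph C4"
proof -
  have fin: "finite (parcs C4)"
    by (rule finite_subset[of _ "{0..<4} \<times> {0..<4}"]) (auto simp: C4_def)
  have loop: "\<And>i::nat. Suc i mod 4 = i \<Longrightarrow> False" "\<And>i::nat. i = Suc i mod 4 \<Longrightarrow> False"
    by presburger+
  show ?thesis
    by unfold_locales
      (use fin in \<open>auto simp: C4_def symmetric_def intro!: symI dest: loop\<close>)
qed

lemma pair_graph_neighborhood_corona:
  assumes "pair_graph G\<^sub>1" "pair_graph G\<^sub>2"
  shows "pair_graph (G\<^sub>1 \<bigstar> G\<^sub>2)"
proof -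
  interpret G1: pair_graph G\<^sub>1 by fact
  interpret G2: pair_graph G\<^sub>2 by fact
  have sub: "parcs (G\<^sub>1 \<bigstar> G\<^sub>2) \<subseteq> pverts (G\<^sub>1 \<bigstar> G\<^sub>2) \<times> pverts (G\<^sub>1 \<bigstar> G\<^sub>2)"
    by (auto simp: neighborhood_corona_def dest: G1.wellformed' G2.wellformed')
  have finv: "finite (pverts (G\<^sub>1 \<bigstar> G\<^sub>2))"
    by (simp add: neighborhood_corona_def)
  have fina: "finite (parcs (G\<^sub>1 \<bigstar> G\<^sub>2))"
    using finite_subset[OF sub] finv by blast
  have sy: "sym (parcs (G\<^sub>1 \<bigstar> G\<^sub>2))"
    by (rule symI)
      (auto simp: neighborhood_corona_def dest: G1.arcs_symmetric G2.arcs_symmetric)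
  have loop: "\<And>e. e \<in> parcs (G\<^sub>1 \<bigstar> G\<^sub>2) \<Longrightarrow> fst e \<noteq> snd e"
    by (auto simp: neighborhood_corona_def dest: G1.no_loops' G2.no_loops')
  show ?thesis
    by unfold_locales (use sub finv fina sy loop in \<open>auto simp: symmetric_def\<close>)
qed

text \<open>
  The adjacency matrix depends on an enumeration \<^term>\<open>vs\<close> of the vertices: row and column
  \<^term>\<open>i\<close> belong to the vertex \<^term>\<open>vs ! i\<close>.
\<close>

definition adjacency_matrix :: "'a pair_pre_digraph \<Rightarrow> 'a list \<Rightarrow> complex mat" where
  "adjacency_matrix G vs =
    mat (length vs) (length vs) (\<lambda>(i, j). if (vs ! i, vs ! j) \<in> parcs G then 1 else 0)"

text \<open>The exponential of a square matrix, as the entrywise sum of the exponential series.\<close>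

definition mat_exp :: "complex mat \<Rightarrow> complex mat" where
  "mat_exp M = mat (dim_row M) (dim_row M) (\<lambda>(i, j). \<Sum>k. (M ^\<^sub>m k) $$ (i, j) / fact k)"

text \<open>
  Another enumeration permutes the rows and columns of the adjacency matrix simultaneously, so
  that for a finite graph it does not matter which enumeration is used below.
\<close>

definition admits_pretty_good_state_transfer :: "'a pair_pre_digraph \<Rightarrow> bool" where
  "admits_pretty_good_state_transfer G \<longleftrightarrow>
    (\<exists>vs. distinct vs \<and> set vs = pverts G \<and>
      (let n = length vs; A = adjacency_matrix G vs in
        \<exists>x < n. \<exists>y < n. x \<noteq> y \<and>
          (\<forall>\<epsilon>::real > 0. \<exists>\<tau>::real.
            cmod (unit_vec n y \<bullet>
              (mat_exp ((- \<i> * complex_of_real \<tau>) \<cdot>\<^sub>m A) *\<^sub>v unit_vec n x)) > 1 - \<epsilon>)))"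

end

theory Submission
  imports "HOL-Computational_Algebra.Polynomial" "HOL-Analysis.Kronecker_Approximation_Theorem" Defs
begin

text \<open>
  If w is an eigenvector of \<^term>\<open>C4\<close> with eigenvalue l, then the vector with value
  \<open>(\<mu> - k) w\<^sub>i\<close> at \<open>Inl i\<close> and \<open>l w\<^sub>i\<close> at \<open>Inr (i, a)\<close> is an eigenvector of the corona with
  eigenvalue \<mu> whenever \<open>(\<mu> - l) (\<mu> - k) = n\<^sub>2 l\<^sup>2\<close>. For \<open>l = 2 \<rho>\<close>, \<open>\<rho> = 1, -1\<close>, the solutions are
  \<open>\<mu> = (2 \<rho> + k + s \<Delta>\<^sub>\<rho>) / 2\<close> with \<open>s = 1, -1\<close> and \<open>\<Delta>\<^sub>\<rho>\<^sup>2 = (2 \<rho> - k)\<^sup>2 + 16 n\<^sub>2\<close>. The state at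
  \<open>Inl 0\<close> is half of \<open>e\<^sub>0 - e\<^sub>2\<close>, which lies in the kernel, plus half of \<open>e\<^sub>0 + e\<^sub>2\<close>, which is a
  combination of these four eigenvectors. Hence the state moves to \<open>Inl 2\<close>, up to the phase -1,
  as soon as \<open>exp (- i \<tau> \<mu>)\<close> is close to -1 for all four \<mu>. As k is divisible by 4, this happens
  at \<open>\<tau> = pi m\<close> for odd m such that both \<open>m \<Delta>\<^sub>\<rho> / 4\<close> are close to integers. Such m exist because
  every rational dependence between 1 and the two irrational square roots involves the square
  roots only, which leaves either Kronecker's theorem or its one-dimensional case.
\<close>

section \<open>Irrational square roots and simultaneous approximation by odd multiples\<close>

lemma sqrt_of_int_rational_imp_Ints:
  assumes "sqrt (of_int n) \<in> \<rat>"
  shows "sqrt (of_int n) \<in> \<int>"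
  by (rule rational_algebraic_int_is_int[OF algebraic_int_sqrt assms]) auto

text \<open>Isolating \<open>c * y\<close> and squaring leaves, as both squares are rational, a
  linear equation for \<open>x\<close> with leading coefficient \<open>2 * a * b\<close>; if
  \<open>b = 0\<close>, then \<open>y\<close> itself would be rational. Nothing can be said about
  \<open>b\<close> and \<open>c\<close>, since \<open>x\<close> and \<open>y\<close> may be
  commensurable.\<close>

lemma irrational_sqrts_combination_int:
  fixes x y :: real and a b c :: int
  assumes x: "x \<notin> \<rat>" "x\<^sup>2 \<in> \<rat>" and y: "y \<notin> \<rat>" "y\<^sup>2 \<in> \<rat>"
    and eq: "a + b * x + c * y = 0"
  shows "a = 0"
proof (rule ccontr)
  assume a: "a \<noteq> 0"
  show False
  proof (cases "b = 0")
    case True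
    with eq a have "c * y = - a"
      by simp
    moreover from this a have "c \<noteq> 0"
      by auto
    ultimately have "y = - of_int a / of_int c"
      by (subst nonzero_eq_divide_eq) (simp_all only: of_int_eq_0_iff mult.commute not_False_eq_True)
    with y show False by simp
  next
    case False
    have "(c * y)\<^sup>2 = (- (a + b * x))\<^sup>2"
      using eq by (intro arg_cong[where f = "\<lambda>u. u\<^sup>2"]) linarith
    then have "x = (c\<^sup>2 * y\<^sup>2 - a\<^sup>2 - b\<^sup>2 * x\<^sup>2) / (2 * a * b)"
      using a False by (simp add: field_simps power2_eq_square)
    also have "\<dots> \<in> \<rat>"
      using x y by simp
    finally show False using x by simp
  qed
qed

text \<open>Writing \<open>m = 2 * k + 1\<close> makes the problem inhomogeneous: multiples of
  \<open>2 * x\<close> and \<open>2 * y\<close> have to approach \<open>- x\<close> and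
  \<open>- y\<close> modulo 1. The assumption \<open>ind\<close> excludes parity obstructions: if
  \<open>2 * x - 2 * y = 1\<close>, then \<open>m * x - m * y\<close> would be half an odd integer
  for every odd \<open>m\<close>.\<close>

lemma odd_multiples_near_Ints:
  fixes x y \<epsilon> :: real
  assumes x: "x \<notin> \<rat>" and y: "y \<notin> \<rat>"
    and ind: "\<And>(a::int) (b::int) (c::int). a + b * x + c * y = 0 \<Longrightarrow> a = 0"
    and \<epsilon>: "\<epsilon> > 0"
  obtains m p q :: int where "odd m" "\<bar>m * x - p\<bar> < \<epsilon>" "\<bar>m * y - q\<bar> < \<epsilon>"
proof (cases "\<exists>(b::int) (c::int). (b \<noteq> 0 \<or> c \<noteq> 0) \<and> b * x + c * y = 0")
  case True
  then obtain b c :: int where bc: "b \<noteq> 0 \<or> c \<noteq> 0" "b * x + c * y = 0"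
    by blast
  have nz: "x \<noteq> 0" "y \<noteq> 0"
    using x y by auto
  with bc have nz': "b \<noteq> 0" "c \<noteq> 0"
    by auto
  \<comment> \<open>Both numbers are integer multiples of this \<open>z\<close>, so an odd multiple
    of \<open>z\<close> close to an integer suffices. The errors grow by the factors
    \<open>\<bar>c\<bar>\<close> and \<open>\<bar>b\<bar>\<close>, hence the tolerance
    \<open>\<epsilon> / (\<bar>b\<bar> + \<bar>c\<bar>)\<close>.\<close>
  define z where "z = x / c"
  have xz: "x = c * z" and yz: "y = - b * z"
    using bc nz' by (auto simp: z_def field_simps add_eq_0_iff)
  have "2 * z \<notin> \<rat>"
  proof
    assume "2 * z \<in> \<rat>"
    then have "2 * z / 2 \<in> \<rat>"
      by (rule Rats_divide) simp
    then have "c * (2 * z / 2) \<in> \<rat>"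
      by (rule Rats_mult[OF Rats_of_int])
    with x xz show False by simp
  qed
  moreover have "\<epsilon> / (\<bar>b\<bar> + \<bar>c\<bar>) > 0"
    using \<epsilon> nz' by simp
  \<comment> \<open>The target \<open>- z\<close> for the multiples of \<open>2 * z\<close> produces
    oddness: the quantity inside the bars is \<open>(2 * k + 1) * z - h\<close>.\<close>
  ultimately obtain h k where hk: "\<bar>of_int k * (2 * z) - of_int h - (- z)\<bar> < \<epsilon> / (\<bar>b\<bar> + \<bar>c\<bar>)"
    by (rule sequence_of_fractional_parts_is_dense)
  define m where "m = 2 * k + 1"
  have mz: "\<bar>m * z - h\<bar> * (\<bar>b\<bar> + \<bar>c\<bar>) < \<epsilon>"
    using hk nz' by (simp add: m_def field_simps)
  have "\<bar>m * x - c * h\<bar> = \<bar>m * z - h\<bar> * \<bar>c\<bar>"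
    unfolding xz by (simp add: abs_mult[symmetric] algebra_simps)
  also have "\<dots> \<le> \<bar>m * z - h\<bar> * (\<bar>b\<bar> + \<bar>c\<bar>)"
    by (intro mult_left_mono) auto
  finally have 1: "\<bar>m * x - (c * h)\<bar> < \<epsilon>"
    using mz by simp
  have "\<bar>m * y - (- b * h)\<bar> = \<bar>m * z - h\<bar> * \<bar>b\<bar>"
    unfolding yz by (simp add: abs_mult[symmetric] algebra_simps)
  also have "\<dots> \<le> \<bar>m * z - h\<bar> * (\<bar>b\<bar> + \<bar>c\<bar>)"
    by (intro mult_left_mono) auto
  finally have 2: "\<bar>m * y - (- b * h)\<bar> < \<epsilon>"
    using mz by simp
  show ?thesis
    by (rule that[of m "c * h" "- b * h"]) (use 1 2 in \<open>auto simp: m_def\<close>)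
next
  case False
  have relation_trivial: "b = 0 \<and> c = 0" if "b * x + c * y = 0" for b c :: int
    using False that by blast
  \<comment> \<open>Kronecker's theorem expresses linear independence over the integers in this
    module.\<close>
  interpret M: Modules.module "\<lambda>(r::int) (x::real). of_int r * x"
    by unfold_locales (auto simp: algebra_simps)
  \<comment> \<open>The first two entries are doubled and shifted by \<open>\<alpha>\<close> to
    reach odd multipliers; the last entry 1 belongs to the form of Kronecker's theorem whose
    multiplier is an integer.\<close>
  define \<theta> where "\<theta> = (\<lambda>i::nat. if i = 0 then 2 * x else if i = 1 then 2 * y else 1)"
  define \<alpha> where "\<alpha> = (\<lambda>i::nat. if i = 0 then - x else - y)"
  have img: "\<theta> ` {..2} = {2 * x, 2 * y, 1}"
    by (auto simp: \<theta>_def atMost_Suc numeral_2_eq_2)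
  \<comment> \<open>Distinctness splits the sum over the set below into three separate terms and
    makes \<open>\<theta>\<close> injective.\<close>
  have ne: "2 * x \<noteq> 1" "2 * y \<noteq> 1" "2 * x \<noteq> 2 * y"
  proof -
    show "2 * x \<noteq> 1" 
      using ind[of "-1" 2 0] by auto
    show "2 * y \<noteq> 1"
      using ind[of "-1" 0 2] by auto
    show "2 * x \<noteq> 2 * y"
      using relation_trivial[of 1 "-1"] by auto
  qed
  have "\<not> M.dependent {2 * x, 2 * y, 1}"
  proof
    assume "M.dependent {2 * x, 2 * y, 1}"
    then obtain u :: "real \<Rightarrow> int" where u: "\<exists>v\<in>{2 * x, 2 * y, 1}. u v \<noteq> 0"
        "(\<Sum>v\<in>{2 * x, 2 * y, 1}. of_int (u v) * v) = 0"
      by (auto simp: M.dependent_finite)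
    from u(2) ne have eq: "u 1 + (2 * u (2 * x)) * x + (2 * u (2 * y)) * y = 0"
      by (simp add: algebra_simps)
    then have "u 1 = 0"
      using ind[of "u 1" "2 * u (2 * x)" "2 * u (2 * y)"] by simp
    with eq have "u (2 * x) * x + u (2 * y) * y = 0"
      by simp
    then have "u (2 * x) = 0 \<and> u (2 * y) = 0"
      by (rule relation_trivial)
    with u(1) \<open>u 1 = 0\<close> show False by auto
  qed
  then have "\<not> M.dependent (\<theta> ` {..2})"
    by (simp only: img not_False_eq_True)
  moreover have "inj_on \<theta> {..2}"
    using ne by (auto simp: inj_on_def \<theta>_def)
  moreover have "\<theta> 2 = 1"
    by (simp add: \<theta>_def)
  ultimately obtain k m where km: "\<And>i. i < 2 \<Longrightarrow> \<bar>of_int k * \<theta> i - of_int (m i) - \<alpha> i\<bar> < \<epsilon>"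
    using Kronecker_thm_2[of \<theta> 2 \<epsilon> \<alpha> thesis] \<epsilon> by blast
  show ?thesis
    by (rule that[of "2 * k + 1" "m 0" "m 1"])
      (use km[of 0] km[of 1] in \<open>auto simp: \<theta>_def \<alpha>_def algebra_simps\<close>)
qed

section \<open>Entries of the matrix exponential from eigenvectors\<close>

lemma pow_mat_mult_eigenvector:
  fixes A :: "'a :: field mat"
  assumes A: "A \<in> carrier_mat n n" and v: "v \<in> carrier_vec n"
    and eig: "A *\<^sub>v v = \<mu> \<cdot>\<^sub>v v"
  shows "(A ^\<^sub>m m) *\<^sub>v v = \<mu> ^ m \<cdot>\<^sub>v v"
proof (induction m)
  case 0
  show ?case using A v by simp
next
  case (Suc m)
  have "(A ^\<^sub>m Suc m) *\<^sub>v v = (A ^\<^sub>m m) *\<^sub>v (A *\<^sub>v v)"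
    using A v by (simp add: assoc_mult_mat_vec[of _ n n _ n])
  also have "\<dots> = \<mu> \<cdot>\<^sub>v ((A ^\<^sub>m m) *\<^sub>v v)"
    unfolding eig using A v by (simp add: mult_mat_vec[of _ n n])
  finally show ?case
    by (simp add: Suc.IH smult_smult_assoc)
qed

lemma smult_mat_mult_vec:
  fixes A :: "'a :: comm_ring_1 mat"
  assumes "A \<in> carrier_mat m n" "v \<in> carrier_vec n"
  shows "(c \<cdot>\<^sub>m A) *\<^sub>v v = c \<cdot>\<^sub>v (A *\<^sub>v v)"
  using assms by (intro eq_vecI) (auto simp: scalar_prod_def sum_distrib_left mult.assoc)

text \<open>A decomposition of one unit vector into eigenvectors determines one column of every
  power, and so of the exponential: the powers act on each summand by \<open>\<mu> j ^ m\<close>,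
  and the scalar exponential series are then added up.\<close>

lemma mat_exp_index_eigenvectors:
  fixes v :: "'j \<Rightarrow> complex vec"
  assumes A: "A \<in> carrier_mat n n" and xy: "x < n" "y < n"
    and v: "\<And>j. j \<in> J \<Longrightarrow> v j \<in> carrier_vec n"
    and eig: "\<And>j. j \<in> J \<Longrightarrow> A *\<^sub>v v j = \<mu> j \<cdot>\<^sub>v v j"
    and sum_v: "\<And>i. i < n \<Longrightarrow> (\<Sum>j\<in>J. v j $ i) = (if i = x then 1 else 0)"
  shows "mat_exp A $$ (y, x) = (\<Sum>j\<in>J. exp (\<mu> j) * v j $ y)"
proof -
  have entry: "(A ^\<^sub>m m) $$ (y, x) = (\<Sum>j\<in>J. \<mu> j ^ m * v j $ y)" for m
  proof -
    have "(A ^\<^sub>m m) $$ (y, x) = (\<Sum>i<n. (A ^\<^sub>m m) $$ (y, i) * (if i = x then 1 else 0))"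
      using xy by (simp add: if_distrib[of "\<lambda>t. _ * t"] cong: if_cong)
    also have "\<dots> = (\<Sum>i<n. \<Sum>j\<in>J. (A ^\<^sub>m m) $$ (y, i) * v j $ i)"
      by (intro sum.cong refl) (simp add: sum_v[symmetric] sum_distrib_left)
    also have "\<dots> = (\<Sum>j\<in>J. \<Sum>i<n. (A ^\<^sub>m m) $$ (y, i) * v j $ i)"
      by (rule sum.swap)
    also have "\<dots> = (\<Sum>j\<in>J. ((A ^\<^sub>m m) *\<^sub>v v j) $ y)"
      using xy carrier_matD[OF pow_carrier_mat[OF A, of m]] carrier_vecD[OF v]
      by (intro sum.cong refl) (auto simp: scalar_prod_def lessThan_atLeast0 intro!: sum.cong)
    also have "\<dots> = (\<Sum>j\<in>J. \<mu> j ^ m * v j $ y)"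
    proof (intro sum.cong refl)
      fix j assume "j \<in> J"
      then show "((A ^\<^sub>m m) *\<^sub>v v j) $ y = \<mu> j ^ m * v j $ y"
        using pow_mat_mult_eigenvector[OF A v eig] v[of j] xy by simp
    qed
    finally show ?thesis .
  qed
  have "(\<lambda>m. \<Sum>j\<in>J. \<mu> j ^ m /\<^sub>R fact m * v j $ y) sums (\<Sum>j\<in>J. exp (\<mu> j) * v j $ y)"
    by (intro sums_sum sums_mult2 exp_converges)
  also have "(\<lambda>m. \<Sum>j\<in>J. \<mu> j ^ m /\<^sub>R fact m * v j $ y) = (\<lambda>m. (A ^\<^sub>m m) $$ (y, x) / fact m)"
    by (simp add: entry sum_divide_distrib scaleR_conv_of_real field_simps)
  finally show ?thesis
    using A xy by (simp add: mat_exp_def sums_iff)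
qed

section \<open>From eigenfunctions on the vertices to state transfer\<close>

text \<open>The adjacency operator on functions, independent of any enumeration of the
  vertices.\<close>

definition neighbor_sum :: "'a pair_pre_digraph \<Rightarrow> ('a \<Rightarrow> real) \<Rightarrow> 'a \<Rightarrow> real" where
  "neighbor_sum G f u = (\<Sum>w\<in>pverts G. if (u, w) \<in> parcs G then f w else 0)"

lemma adjacency_matrix_mult_vec:
  assumes vs: "distinct vs" "set vs = pverts G"
  shows "adjacency_matrix G vs *\<^sub>v vec (length vs) (\<lambda>i. complex_of_real (f (vs ! i)))
    = vec (length vs) (\<lambda>i. complex_of_real (neighbor_sum G f (vs ! i)))"
proof (rule eq_vecI)
  fix i assume i: "i < dim_vec (vec (length vs) (\<lambda>i. complex_of_real (neighbor_sum G f (vs ! i))))"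
  have "(adjacency_matrix G vs *\<^sub>v vec (length vs) (\<lambda>i. complex_of_real (f (vs ! i)))) $ i
      = (\<Sum>j<length vs. complex_of_real (if (vs ! i, vs ! j) \<in> parcs G then f (vs ! j) else 0))"
    using i by (auto simp: adjacency_matrix_def scalar_prod_def lessThan_atLeast0 intro!: sum.cong)
  also have "\<dots> = (\<Sum>w\<in>pverts G. complex_of_real (if (vs ! i, w) \<in> parcs G then f w else 0))"
    by (rule sum.reindex_bij_betw[OF bij_betw_nth]) (use vs in auto)
  also have "\<dots> = vec (length vs) (\<lambda>i. complex_of_real (neighbor_sum G f (vs ! i))) $ i"
    using i by (simp add: neighbor_sum_def)
  finally show "(adjacency_matrix G vs *\<^sub>v vec (length vs) (\<lambda>i. complex_of_real (f (vs ! i)))) $ i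
      = vec (length vs) (\<lambda>i. complex_of_real (neighbor_sum G f (vs ! i))) $ i" .
qed (simp add: adjacency_matrix_def)

text \<open>The amplitude at \<open>y\<close> is the sum of
  \<open>exp (- \<i> * \<tau> * \<mu> j) * f j y\<close>. Replacing each phase by its target
  \<open>\<gamma> * \<sigma> j\<close> turns it into \<open>\<gamma>\<close> times the sum of the
  \<open>f j x\<close>, which is \<open>\<gamma>\<close>. The signs \<open>\<sigma> j\<close>
  express the cospectrality of \<open>x\<close> and \<open>y\<close> relative to this
  decomposition.\<close>

lemma pretty_good_state_transferI:
  fixes f :: "'j \<Rightarrow> 'a \<Rightarrow> real" and \<mu> \<sigma> :: "'j \<Rightarrow> real" and \<gamma> :: complex
  assumes fin: "finite (pverts G)" and xy: "x \<in> pverts G" "y \<in> pverts G" "x \<noteq> y"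
    and eig: "\<And>j u. j \<in> J \<Longrightarrow> u \<in> pverts G \<Longrightarrow> neighbor_sum G (f j) u = \<mu> j * f j u"
    and sum_f: "\<And>u. u \<in> pverts G \<Longrightarrow> (\<Sum>j\<in>J. f j u) = (if u = x then 1 else 0)"
    and cosp: "\<And>j. j \<in> J \<Longrightarrow> f j y = \<sigma> j * f j x" "\<And>j. j \<in> J \<Longrightarrow> (\<sigma> j)\<^sup>2 = 1"
    and \<gamma>: "cmod \<gamma> = 1"
    and times: "\<And>\<delta>::real. \<delta> > 0 \<Longrightarrow>
      \<exists>\<tau>::real. \<forall>j\<in>J. cmod (exp (- \<i> * of_real \<tau> * of_real (\<mu> j)) - \<gamma> * of_real (\<sigma> j)) \<le> \<delta>"
  shows "admits_pretty_good_state_transfer G"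
proof -
  obtain vs where vs: "set vs = pverts G" "distinct vs"
    using finite_distinct_list[OF fin] by blast
  define n where "n = length vs"
  define A where "A = adjacency_matrix G vs"
  obtain p q where pq: "p < n" "q < n" "vs ! p = x" "vs ! q = y"
    using xy vs unfolding n_def by (metis in_set_conv_nth)
  have A: "A \<in> carrier_mat n n"
    by (simp add: A_def adjacency_matrix_def n_def)
  define v where "v j = vec n (\<lambda>i. complex_of_real (f j (vs ! i)))" for j
  have v_carrier: "v j \<in> carrier_vec n" for j
    by (simp add: v_def)
  have nth: "vs ! i \<in> pverts G" if "i < n" for i
    using that by (simp add: n_def flip: vs(1))
  have Av: "A *\<^sub>v v j = of_real (\<mu> j) \<cdot>\<^sub>v v j" if "j \<in> J" for j
    unfolding A_def v_def adjacency_matrix_mult_vec[OF vs(2,1), folded n_def]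
    by (intro eq_vecI) (simp_all add: eig[OF that nth])
  have amplitude: "unit_vec n q \<bullet> (mat_exp ((- \<i> * complex_of_real \<tau>) \<cdot>\<^sub>m A) *\<^sub>v unit_vec n p)
      = (\<Sum>j\<in>J. exp (- \<i> * of_real \<tau> * of_real (\<mu> j)) * of_real (f j y))" for \<tau>
  proof -
    let ?M = "(- \<i> * complex_of_real \<tau>) \<cdot>\<^sub>m A"
    have "mat_exp ?M \<in> carrier_mat n n"
      using A by (simp add: mat_exp_def)
    then have "unit_vec n q \<bullet> (mat_exp ?M *\<^sub>v unit_vec n p) = mat_exp ?M $$ (q, p)"
      using pq by (subst scalar_prod_left_unit[of _ n]) auto
    also have "\<dots> = (\<Sum>j\<in>J. exp (- \<i> * of_real \<tau> * of_real (\<mu> j)) * v j $ q)"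
    proof (rule mat_exp_index_eigenvectors)
      show "?M \<in> carrier_mat n n" using A by simp
      fix j assume "j \<in> J"
      show "?M *\<^sub>v v j = (- \<i> * of_real \<tau> * of_real (\<mu> j)) \<cdot>\<^sub>v v j"
        by (simp add: smult_mat_mult_vec[OF A, of "v j"] Av[OF \<open>j \<in> J\<close>] v_carrier smult_smult_assoc)
    next
      fix i assume "i < n"
      then have "(\<Sum>j\<in>J. v j $ i) = complex_of_real (\<Sum>j\<in>J. f j (vs ! i))"
        by (simp add: v_def)
      also have "\<dots> = (if i = p then 1 else 0)"
        using \<open>i < n\<close> pq nth_eq_iff_index_eq[OF vs(2), of i p] by (simp add: sum_f nth n_def)
      finally show "(\<Sum>j\<in>J. v j $ i) = (if i = p then 1 else 0)" .
    qed (use pq in \<open>auto simp: v_def\<close>)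
    finally show ?thesis
      using pq by (simp add: v_def)
  qed
  have "\<exists>\<tau>. cmod (unit_vec n q \<bullet> (mat_exp ((- \<i> * complex_of_real \<tau>) \<cdot>\<^sub>m A) *\<^sub>v unit_vec n p)) > 1 - \<epsilon>"
    if "\<epsilon> > 0" for \<epsilon> :: real
  proof -
    \<comment> \<open>The total weight of the phase errors. Dividing by \<open>B + 1\<close> avoids
      a zero denominator and makes the final estimate strict.\<close>
    define B where "B = (\<Sum>j\<in>J. \<bar>f j y\<bar>)"
    have B: "B \<ge> 0"
      by (simp add: B_def sum_nonneg)
    then have "\<epsilon> / (B + 1) > 0"
      using that by simp
    from times[OF this] obtain \<tau> :: real
      where \<tau>: "\<And>j. j \<in> J \<Longrightarrow> cmod (exp (- \<i> * of_real \<tau> * of_real (\<mu> j)) - \<gamma> * of_real (\<sigma> j)) \<le> \<epsilon> / (B + 1)"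
      by blast
    let ?S = "\<Sum>j\<in>J. exp (- \<i> * of_real \<tau> * of_real (\<mu> j)) * complex_of_real (f j y)"
    have "(\<Sum>j\<in>J. \<gamma> * of_real (\<sigma> j) * complex_of_real (f j y))
        = (\<Sum>j\<in>J. \<gamma> * complex_of_real (f j x))"
    proof (intro sum.cong refl)
      fix j assume "j \<in> J"
      then have "\<sigma> j * f j y = f j x"
        using cosp[of j] by (simp add: power2_eq_square flip: mult.assoc)
      then show "\<gamma> * of_real (\<sigma> j) * complex_of_real (f j y) = \<gamma> * complex_of_real (f j x)"
        by (metis mult.assoc of_real_mult)
    qed
    also have "\<dots> = \<gamma> * of_real (\<Sum>j\<in>J. f j x)"
      by (simp add: sum_distrib_left)
    also have "\<dots> = \<gamma>"
      using xy by (simp add: sum_f)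
    finally have "cmod (?S - \<gamma>)
        = cmod (\<Sum>j\<in>J. (exp (- \<i> * of_real \<tau> * of_real (\<mu> j)) - \<gamma> * of_real (\<sigma> j)) * complex_of_real (f j y))"
      by (simp add: left_diff_distrib sum_subtractf)
    also have "\<dots> \<le> (\<Sum>j\<in>J. \<epsilon> / (B + 1) * \<bar>f j y\<bar>)"
      using \<tau> by (intro sum_norm_le) (simp only: norm_mult norm_of_real mult_right_mono abs_ge_zero)
    also have "\<dots> = \<epsilon> / (B + 1) * B"
      by (simp add: B_def sum_distrib_left)
    also have "\<dots> < \<epsilon>"
      using B that by (simp add: field_simps)
    finally have "cmod ?S > 1 - \<epsilon>"
      using norm_triangle_ineq2[of \<gamma> ?S] \<gamma> by (simp add: norm_minus_commute)
    then show ?thesis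
      unfolding amplitude[symmetric] by blast
  qed
  moreover have "p \<noteq> q"
    using pq xy by auto
  ultimately show ?thesis
    unfolding admits_pretty_good_state_transfer_def Let_def
    using vs pq by (intro exI[of _ vs]) (auto simp: n_def A_def)
qed

section \<open>Lifting eigenfunctions to the neighborhood corona\<close>

lemma parcs_neighborhood_corona_iff:
  "(Inl u, Inl v) \<in> parcs (G\<^sub>1 \<bigstar> G\<^sub>2) \<longleftrightarrow> (u, v) \<in> parcs G\<^sub>1"
  "(Inl u, Inr (i, a)) \<in> parcs (G\<^sub>1 \<bigstar> G\<^sub>2) \<longleftrightarrow> (u, i) \<in> parcs G\<^sub>1 \<and> a \<in> pverts G\<^sub>2"
  "(Inr (i, a), Inl u) \<in> parcs (G\<^sub>1 \<bigstar> G\<^sub>2) \<longleftrightarrow> (u, i) \<in> parcs G\<^sub>1 \<and> a \<in> pverts G\<^sub>2"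
  "(Inr (i, a), Inr (j, b)) \<in> parcs (G\<^sub>1 \<bigstar> G\<^sub>2) \<longleftrightarrow> j = i \<and> i \<in> pverts G\<^sub>1 \<and> (a, b) \<in> parcs G\<^sub>2"
  by (auto simp: neighborhood_corona_def)

text \<open>As \<open>f\<close> is constant on each copy of \<open>G\<^sub>2\<close>, regularity
  reduces the adjacency operator to the 2 by 2 matrix with rows
  \<open>(l, card (pverts G\<^sub>2) * l)\<close> and \<open>(l, k)\<close>. The two equations say
  that \<open>(\<alpha>, \<beta>)\<close> is an eigenvector of it for \<open>\<mu>\<close>.\<close>

lemma neighbor_sum_corona_eigenfunction:
  fixes w :: "'a \<Rightarrow> real" and \<alpha> \<beta> l \<mu> :: real
  assumes G1: "pair_graph G\<^sub>1" and G2: "pair_graph G\<^sub>2" and reg: "regular_graph G\<^sub>2 k"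
    and w: "\<And>i. i \<in> pverts G\<^sub>1 \<Longrightarrow> neighbor_sum G\<^sub>1 w i = l * w i"
    and \<alpha>: "l * \<alpha> + card (pverts G\<^sub>2) * l * \<beta> = \<mu> * \<alpha>"
    and \<beta>: "l * \<alpha> + k * \<beta> = \<mu> * \<beta>"
    and u: "u \<in> pverts (G\<^sub>1 \<bigstar> G\<^sub>2)"
  defines "f \<equiv> case_sum (\<lambda>i. \<alpha> * w i) (\<lambda>(i, a). \<beta> * w i)"
  shows "neighbor_sum (G\<^sub>1 \<bigstar> G\<^sub>2) f u = \<mu> * f u"
proof -
  interpret G1: pair_graph G\<^sub>1 by fact
  interpret G2: pair_graph G\<^sub>2 by fact
  let ?V = "pverts G\<^sub>1" and ?W = "pverts G\<^sub>2"
  have V: "pverts (G\<^sub>1 \<bigstar> G\<^sub>2) = ?V <+> ?V \<times> ?W"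
    by (simp add: neighborhood_corona_def)
  have split: "neighbor_sum (G\<^sub>1 \<bigstar> G\<^sub>2) f u =
      (\<Sum>i\<in>?V. if (u, Inl i) \<in> parcs (G\<^sub>1 \<bigstar> G\<^sub>2) then \<alpha> * w i else 0) +
      (\<Sum>i\<in>?V. \<Sum>b\<in>?W. if (u, Inr (i, b)) \<in> parcs (G\<^sub>1 \<bigstar> G\<^sub>2) then \<beta> * w i else 0)" for u
    by (simp add: neighbor_sum_def V sum.Plus sum.cartesian_product f_def comp_def case_prod_unfold
        cong: if_cong)
  have sum_w: "(\<Sum>j\<in>?V. if (i, j) \<in> parcs G\<^sub>1 then c * w j else 0) = c * (l * w i)"
    if "i \<in> ?V" for i c
  proof -
    have "(\<Sum>j\<in>?V. if (i, j) \<in> parcs G\<^sub>1 then c * w j else 0) = c * neighbor_sum G\<^sub>1 w i"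
      unfolding neighbor_sum_def sum_distrib_left by (intro sum.cong) auto
    then show ?thesis
      by (simp add: w that)
  qed
  \<comment> \<open>The arcs from a copy back to \<open>G\<^sub>1\<close> are described by
    \<open>(u, i)\<close>, whereas the neighbor sum at \<open>i\<close> tests
    \<open>(i, u)\<close>.\<close>
  have sym_iff: "(j, i) \<in> parcs G\<^sub>1 \<longleftrightarrow> (i, j) \<in> parcs G\<^sub>1" for i j
    by (auto dest: G1.arcs_symmetric)
  show ?thesis
  proof (cases u)
    case (Inl i)
    then have i: "i \<in> ?V"
      using u by (auto simp: neighborhood_corona_def)
    have "neighbor_sum (G\<^sub>1 \<bigstar> G\<^sub>2) f u =
        (\<Sum>j\<in>?V. if (i, j) \<in> parcs G\<^sub>1 then \<alpha> * w j else 0) +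
        (\<Sum>j\<in>?V. if (i, j) \<in> parcs G\<^sub>1 then (card ?W * \<beta>) * w j else 0)"
      unfolding split Inl parcs_neighborhood_corona_iff
      by (intro arg_cong2[where f = "(+)"] sum.cong refl) simp
    also have "\<dots> = (l * \<alpha> + card ?W * l * \<beta>) * w i"
      unfolding sum_w[OF i] by (simp add: algebra_simps)
    finally show ?thesis
      by (simp add: \<alpha> Inl f_def)
  next
    case (Inr p)
    then obtain i a where Inr: "u = Inr (i, a)" and i: "i \<in> ?V" and a: "a \<in> ?W"
      using u by (cases p) (auto simp: neighborhood_corona_def)
    have "out_arcs (with_proj G\<^sub>2) a = Pair a ` {b \<in> ?W. (a, b) \<in> parcs G\<^sub>2}"
      by (auto simp: out_arcs_def dest: G2.wellformed')
    then have "card (out_arcs (with_proj G\<^sub>2) a) = card {b \<in> ?W. (a, b) \<in> parcs G\<^sub>2}"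
      by (simp only:) (intro card_image inj_onI, simp)
    moreover have "card (out_arcs (with_proj G\<^sub>2) a) = k"
      using reg a unfolding regular_graph_def out_degree_def by blast
    ultimately have deg: "card {b \<in> ?W. (a, b) \<in> parcs G\<^sub>2} = k"
      by simp
    \<comment> \<open>Among the copies only the \<open>i\<close>-th one is adjacent to
      \<open>Inr (i, a)\<close>, and it contributes \<open>k\<close> equal terms.\<close>
    have inner: "(\<Sum>b\<in>?W. if j = i \<and> i \<in> ?V \<and> (a, b) \<in> parcs G\<^sub>2 then \<beta> * w j else 0)
        = (if j = i then k * (\<beta> * w i) else 0)" for j
      using i by (cases "j = i") (simp_all add: deg flip: sum.inter_filter)
    have "neighbor_sum (G\<^sub>1 \<bigstar> G\<^sub>2) f u =
        (\<Sum>j\<in>?V. if (i, j) \<in> parcs G\<^sub>1 then \<alpha> * w j else 0) +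
        (\<Sum>j\<in>?V. if j = i then k * (\<beta> * w i) else 0)"
      unfolding split Inr parcs_neighborhood_corona_iff inner using a sym_iff[of _ i] by simp
    also have "\<dots> = \<alpha> * (l * w i) + k * (\<beta> * w i)"
      using i by (simp only: sum_w sum.delta G1.pair_finite_verts if_True)
    also have "\<dots> = (l * \<alpha> + k * \<beta>) * w i"
      by (simp add: algebra_simps)
    finally show ?thesis
      by (simp add: \<beta> Inr f_def)
  qed
qed

section \<open>The 4-cycle and the phase estimate\<close>

lemma pverts_C4: "pverts C4 = {0, 1, 2, 3}"
  by (auto simp: C4_def)

lemma parcs_C4_iff:
  "(i, j) \<in> parcs C4 \<longleftrightarrow> i < 4 \<and> j < 4 \<and> (j = (i + 1) mod 4 \<or> i = (j + 1) mod 4)"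
  by (simp add: C4_def)

text \<open>Adding 3 modulo 4 gives the predecessor without truncated subtraction.\<close>

lemma neighbor_sum_C4:
  assumes "i \<in> pverts C4"
  shows "neighbor_sum C4 w i = w ((i + 1) mod 4) + w ((i + 3) mod 4)"
proof -
  consider "i = 0" | "i = 1" | "i = 2" | "i = 3"
    using assms by (auto simp: pverts_C4)
  then show ?thesis
    by cases (simp_all add: neighbor_sum_def pverts_C4 parcs_C4_iff, simp_all add: numeral_2_eq_2)
qed

text \<open>For odd \<open>q\<close> the point -1 is \<open>cis (pi * q)\<close>, and a chord of the
  unit circle is no longer than the arc.\<close>

lemma cmod_exp_add_one_le:
  fixes \<theta> :: real and q :: int
  assumes "odd q"
  shows "cmod (exp (- \<i> * of_real \<theta>) + 1) \<le> \<bar>\<theta> - pi * q\<bar>"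
proof -
  define t where "t = pi * q - \<theta>"
  have "exp (- \<i> * of_real \<theta>) = cis (t - pi * q)"
    by (simp add: t_def cis_conv_exp)
  also have "\<dots> = - cis t"
  proof -
    have "cis (pi * q) = -1"
      using assms by (auto simp: complex_eq_iff)
    then show ?thesis
      by (simp add: cis_divide[symmetric])
  qed
  finally have "cmod (exp (- \<i> * of_real \<theta>) + 1) = cmod (exp (\<i> * of_real t) - 1)"
    by (simp add: cis_conv_exp norm_minus_commute)
  also have "\<dots> = 2 * \<bar>sin (t / 2)\<bar>"
    by (rule dist_exp_i_1)
  also have "\<dots> \<le> \<bar>t\<bar>"
    using abs_sin_x_le_abs_x[of "t / 2"] by simp
  finally show ?thesis
    by (simp add: t_def abs_minus_commute)
qed

section \<open>Eigenfunctions and transfer times for the corona of the 4-cycle\<close>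

theorem theorem5p3:
  fixes G\<^sub>2 :: "'b pair_pre_digraph" and k n\<^sub>2 :: nat
  assumes "pair_graph G\<^sub>2"
    and "Digraph_Component.connected (with_proj G\<^sub>2)"
    and "regular_graph G\<^sub>2 k"
    and "n\<^sub>2 = card (pverts G\<^sub>2)"
    and "sqrt ((2 + real k)\<^sup>2 + 16 * real n\<^sub>2) \<notin> \<int>"
    and "sqrt ((2 - real k)\<^sup>2 + 16 * real n\<^sub>2) \<notin> \<int>"
    and "[k = 0] (mod 4)"
  shows "admits_pretty_good_state_transfer (C4 \<bigstar> G\<^sub>2)"
proof -
  define \<Delta> where "\<Delta> \<rho> = sqrt ((2 * of_int \<rho> - real k)\<^sup>2 + 16 * real n\<^sub>2)" for \<rho> :: int
  \<comment> \<open>The index \<open>None\<close> denotes the kernel function,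
    \<open>Some (\<rho>, s)\<close> the other four. For \<open>None\<close> the value
    \<open>l = 0\<close> makes the function vanish on all copies.\<close>
  define \<mu> where "\<mu> = case_option 0 (\<lambda>(\<rho>, s). (2 * of_int \<rho> + real k + of_int s * \<Delta> \<rho>) / 2)"
  define l :: "(int \<times> int) option \<Rightarrow> real"
    where "l = case_option 0 (\<lambda>(\<rho>, s). 2 * of_int \<rho>)"
  define \<alpha> where "\<alpha> = case_option 1 (\<lambda>p. \<mu> (Some p) - real k)"
  \<comment> \<open>The weights are built in so that the eigenfunctions add up to the indicator of
    \<open>Inl 0\<close>. For fixed \<open>\<rho>\<close> the two values of \<mu> differ by
    \<open>\<Delta> \<rho>\<close>, so summing over \<open>s\<close> gives
    \<open>\<rho> ^ i / 4\<close> at \<open>Inl i\<close> and 0 on the copies.\<close>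
  define w :: "(int \<times> int) option \<Rightarrow> nat \<Rightarrow> real"
    where "w = case_option (\<lambda>i. if i = 0 then 1 / 2 else if i = 2 then - 1 / 2 else 0)
      (\<lambda>(\<rho>, s) i. of_int s / (4 * \<Delta> \<rho>) * of_int \<rho> ^ i)"
  define f :: "(int \<times> int) option \<Rightarrow> nat + nat \<times> 'b \<Rightarrow> real"
    where "f j = case_sum (\<lambda>i. \<alpha> j * w j i) (\<lambda>(i, a). l j * w j i)" for j
  \<comment> \<open>Together with the global phase -1 used below, the target phase is 1 for
    \<open>None\<close> and -1 for the other four.\<close>
  define \<sigma> :: "(int \<times> int) option \<Rightarrow> real" where "\<sigma> = case_option (- 1) (\<lambda>_. 1)"
  define J :: "(int \<times> int) option set"
    where "J = {None, Some (1, 1), Some (1, - 1), Some (- 1, 1), Some (- 1, - 1)}"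
  have \<Delta>_sq: "(\<Delta> \<rho>)\<^sup>2 = (2 * of_int \<rho> - real k)\<^sup>2 + 16 * real n\<^sub>2" for \<rho>
    by (simp add: \<Delta>_def)
  have irrational: "\<Delta> 1 \<notin> \<rat>" "\<Delta> (- 1) \<notin> \<rat>"
  proof -
    have \<Delta>_int: "\<Delta> \<rho> = sqrt (of_int ((2 * \<rho> - int k)\<^sup>2 + 16 * int n\<^sub>2))" for \<rho>
      by (simp add: \<Delta>_def)
    have "\<Delta> 1 \<notin> \<int>"
      using assms(6) by (simp add: \<Delta>_def)
    then show "\<Delta> 1 \<notin> \<rat>"
      unfolding \<Delta>_int using sqrt_of_int_rational_imp_Ints by blast
    \<comment> \<open>The hypothesis with \<open>2 + k\<close> is the one that concerns
      \<open>\<rho> = -1\<close>.\<close>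
    have "(- 2 - real k)\<^sup>2 = (2 + real k)\<^sup>2"
      by (simp add: power2_eq_square algebra_simps)
    then have "\<Delta> (- 1) \<notin> \<int>"
      using assms(5) by (simp add: \<Delta>_def)
    then show "\<Delta> (- 1) \<notin> \<rat>"
      unfolding \<Delta>_int using sqrt_of_int_rational_imp_Ints by blast
  qed
  then have \<Delta>_nz: "\<Delta> 1 \<noteq> 0" "\<Delta> (- 1) \<noteq> 0"
    by auto
  have J_cases: "j = None \<or> (\<exists>\<rho> s. j = Some (\<rho>, s) \<and> \<rho> \<in> {1, - 1} \<and> s \<in> {1, - 1})" if "j \<in> J" for j
    using that by (auto simp: J_def)
  show ?thesis
  proof (rule pretty_good_state_transferI)
    show "finite (pverts (C4 \<bigstar> G\<^sub>2))"
      using pair_graph_neighborhood_corona[OF pair_graph_C4 assms(1)]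
      by (simp add: pair_fin_digraph.pair_finite_verts pair_digraph_def pair_graph_def)
    show "Inl 0 \<in> pverts (C4 \<bigstar> G\<^sub>2)" "Inl 2 \<in> pverts (C4 \<bigstar> G\<^sub>2)"
      by (auto simp: neighborhood_corona_def pverts_C4)
    show "(Inl 0 :: nat + nat \<times> 'b) \<noteq> Inl 2" "cmod (- 1) = 1"
      by auto
  next
    fix j u assume j: "j \<in> J" and u: "u \<in> pverts (C4 \<bigstar> G\<^sub>2)"
    show "neighbor_sum (C4 \<bigstar> G\<^sub>2) (f j) u = \<mu> j * f j u"
      unfolding f_def
    proof (rule neighbor_sum_corona_eigenfunction[OF pair_graph_C4 assms(1,3) _ _ _ u])
      fix i assume i: "i \<in> pverts C4"
      then have "i = 0 \<or> i = 1 \<or> i = 2 \<or> i = 3"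
        by (auto simp: pverts_C4)
      then show "neighbor_sum C4 (w j) i = l j * w j i"
        unfolding neighbor_sum_C4[OF i] using J_cases[OF j]
        by (elim disjE exE conjE insertE) (simp_all add: w_def l_def)
    next
      show "l j * \<alpha> j + real (card (pverts G\<^sub>2)) * l j * l j = \<mu> j * \<alpha> j"
      proof (cases "j = None")
        case True
        then show ?thesis
          by (simp add: l_def \<mu>_def)
      next
        case False
        then obtain \<rho> s where js: "j = Some (\<rho>, s)" "\<rho> \<in> {1, - 1}" "s \<in> {1, - 1}"
          using J_cases[OF j] by blast
        \<comment> \<open>With \<open>\<alpha> = \<mu> - k\<close> and \<open>\<beta> = l\<close>
          the first equation becomes this quadratic one. The two factors are
          \<open>(s * \<Delta> \<rho> - d) / 2\<close> and
          \<open>(s * \<Delta> \<rho> + d) / 2\<close> with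
          \<open>d = 2 * \<rho> - k\<close>.\<close>
        have "(\<mu> j - l j) * (\<mu> j - real k)
            = ((of_int s)\<^sup>2 * (\<Delta> \<rho>)\<^sup>2 - (2 * of_int \<rho> - real k)\<^sup>2) / 4"
          by (simp add: \<mu>_def l_def js(1) power2_eq_square field_simps)
        also have "(of_int s)\<^sup>2 = (1::real)"
          using js(3) by auto
        also have "(1 * (\<Delta> \<rho>)\<^sup>2 - (2 * of_int \<rho> - real k)\<^sup>2) / 4 = real n\<^sub>2 * (l j * l j)"
          using js(2) by (auto simp: \<Delta>_sq l_def js(1))
        finally show ?thesis
          by (simp add: \<alpha>_def js(1) assms(4) algebra_simps)
      qed
      show "l j * \<alpha> j + real k * l j = \<mu> j * l j"
        using J_cases[OF j] by (auto simp: l_def \<alpha>_def algebra_simps)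
    qed
  next
    fix u assume u: "u \<in> pverts (C4 \<bigstar> G\<^sub>2)"
    show "(\<Sum>j\<in>J. f j u) = (if u = Inl 0 then 1 else 0)"
    proof (cases u)
      case (Inl i)
      with u have "i = 0 \<or> i = 1 \<or> i = 2 \<or> i = 3"
        by (auto simp: neighborhood_corona_def pverts_C4)
      then show ?thesis
        using Inl \<Delta>_nz by (elim disjE) (simp_all add: J_def f_def \<alpha>_def \<mu>_def w_def field_simps)
    next
      case (Inr p)
      then show ?thesis
        using \<Delta>_nz by (cases p) (simp add: J_def f_def l_def w_def)
    qed
  next
    fix j assume j: "j \<in> J"
    show "f j (Inl 2) = \<sigma> j * f j (Inl 0)"
      using J_cases[OF j] by (auto simp: f_def \<alpha>_def w_def \<sigma>_def)
    show "(\<sigma> j)\<^sup>2 = 1"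
      by (simp add: \<sigma>_def split: option.split)
  next
    fix \<delta> :: real assume \<delta>: "\<delta> > 0"
    obtain r where r: "k = 4 * r"
      using assms(7) by (auto simp: cong_0_iff)
    \<comment> \<open>At time \<open>pi * m\<close> the phase angle divided by pi is
      \<open>m * (\<rho> + 2 * r) + 2 * s * (m * \<Delta> \<rho> / 4)\<close>. The first term is
      odd, so the quarter of \<Delta> is what has to be near an integer after multiplication by
      \<open>m\<close>; the factor \<open>2 * pi\<close> explains the tolerance.\<close>
    obtain m p q :: int where m: "odd m"
      and p: "\<bar>m * (\<Delta> 1 / 4) - p\<bar> < \<delta> / (2 * pi)" and q: "\<bar>m * (\<Delta> (- 1) / 4) - q\<bar> < \<delta> / (2 * pi)"
    proof (rule odd_multiples_near_Ints)
      have quarter: "x \<in> \<rat>" if "x / 4 \<in> \<rat>" for x :: real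
        using Rats_mult[OF that Rats_number_of[of "num.Bit0 (num.Bit0 num.One)"]] by simp
      show irr: "\<Delta> 1 / 4 \<notin> \<rat>" "\<Delta> (- 1) / 4 \<notin> \<rat>"
        using irrational quarter by blast+
      have sq: "(\<Delta> \<rho> / 4)\<^sup>2 \<in> \<rat>" for \<rho>
        by (simp add: power_divide \<Delta>_sq)
      show "a = 0" if "a + b * (\<Delta> 1 / 4) + c * (\<Delta> (- 1) / 4) = 0" for a b c :: int
        using irrational_sqrts_combination_int[OF irr(1) sq irr(2) sq that] .
      show "\<delta> / (2 * pi) > 0"
        using \<delta> by simp
    qed
    have "cmod (exp (- \<i> * of_real (pi * m) * of_real (\<mu> j)) - (- 1) * of_real (\<sigma> j)) \<le> \<delta>"
      if j: "j \<in> J" for j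
    proof (cases "j = None")
      case True
      \<comment> \<open>The eigenvalue 0 has phase exactly 1 at all times.\<close>
      then show ?thesis
        using \<delta> by (simp add: \<mu>_def \<sigma>_def)
    next
      case False
      then obtain \<rho> s where js: "j = Some (\<rho>, s)" "\<rho> \<in> {1, - 1}" "s \<in> {1, - 1}"
        using J_cases[OF j] by blast
      obtain h :: int where h: "\<bar>m * (\<Delta> \<rho> / 4) - h\<bar> < \<delta> / (2 * pi)"
        using js(2) p q by blast
      \<comment> \<open>The phase angle over pi with \<open>m * \<Delta> \<rho> / 4\<close> rounded
        to \<open>h\<close>; its parity is that of \<open>m * \<rho>\<close>.\<close>
      define t where "t = m * (\<rho> + 2 * int r) + 2 * s * h"
      have "odd t"
        using m js(2) by (auto simp: t_def)
      have "pi * m * \<mu> j - pi * t = 2 * pi * (s * (m * (\<Delta> \<rho> / 4) - h))"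
        by (simp add: t_def js(1) \<mu>_def r field_simps)
      then have "\<bar>pi * m * \<mu> j - pi * t\<bar> = 2 * pi * \<bar>m * (\<Delta> \<rho> / 4) - h\<bar>"
        using js(3) by (auto simp: abs_mult)
      also have "\<dots> \<le> \<delta>"
        using h by (simp add: field_simps)
      finally show ?thesis
        using cmod_exp_add_one_le[OF \<open>odd t\<close>, of "pi * m * \<mu> j"] by (simp add: \<sigma>_def js(1) mult.assoc)
    qed
    then show "\<exists>\<tau>::real. \<forall>j\<in>J. cmod (exp (- \<i> * of_real \<tau> * of_real (\<mu> j)) - (- 1) * of_real (\<sigma> j)) \<le> \<delta>"
      by blast
  qed
qed

end
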